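(* A game is weakly miserable if and only if it is domestic.
   Context: A game is a two-player impartial game given by a directed acyclic graph whose vertices are positions and whose arcs are moves, such that from every position only finitely many positions are reachable. A position with no moves is terminal. $\operatorname{mex}(S)$ is the least non-negative integer not in $S$. The normal Sprague–Grundy function is $\mathcal{G}(x)=\operatorname{mex}\{\mathcal{G}(y): x\to y\}$ (so $0$ on terminal positions); the misère Sprague–Grundy function $\mathcal{G}^-$ satisfies $\mathcal{G}^-(x)=1$ for terminal $x$ and $\mathcal{G}^-(x)=\operatorname{mex}\{\mathcal{G}^-(y): x\to y\}$ otherwise. An $(i,j)$-position is a position $x$ with $\mathcal{G}(x)=i$, $\mathcal{G}^-(x)=j$; $V_{i,j}$ denotes the set of $(i,j)$-positions. A position $x$ is movable to a set $W$ if there is a move from $x$ to some position of $W$. A game is domestic if it has no $(0,k)$-position and no $(k,0)$-position with $k\ge 2$. A game is weakly miserable if every position $x$ satisfies at least one of: (a) $x\in V_{0,1}\cup V_{1,0}$; (b) $x$ is not movable to $V_{0,1}\cup V_{1,0}$; (c) $x$ is movable to $V_{0,1}$ and to $V_{1,0}$; (c$_0$) $x$ is movable to $V_{0,1}$ and to $V_{0,0}$; (c$_1$) $x$ is movable to $V_{1,0}$ and to $V_{0,0}$. *)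

theory Defs
  imports Main
begin

definition mex :: "nat set \<Rightarrow> nat" where
  "mex S = (LEAST n. n \<notin> S)"

locale impartial_game =
  fixes V :: "'a set" and E :: "'a rel"
  assumes moves_within: "E \<subseteq> V \<times> V"
    and acyclic_moves: "acyclic E"
    and finite_reachable: "x \<in> V \<Longrightarrow> finite (E\<^sup>* `` {x})"
begin

lemma wf_moves: "wf (E\<inverse>)"
proof (unfold wf_iff_no_infinite_down_chain, rule notI)
  assume "\<exists>f. \<forall>i. (f (Suc i), f i) \<in> E\<inverse>"
  then obtain f where step: "\<And>i. (f (Suc i), f i) \<in> E\<inverse>" by blast
  have path: "i < j \<Longrightarrow> (f i, f j) \<in> E\<^sup>+" for i j
  proof (induction j)
    case (Suc j)
    have "(f j, f (Suc j)) \<in> E" using step by simp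
    with Suc show ?case by (cases "i = j") (auto intro: trancl_into_trancl)
  qed simp
  have "inj f"
  proof (rule linorder_injI)
    fix i j :: nat assume "i < j"
    from path[OF this] show "f i \<noteq> f j"
      using acyclic_moves by (auto simp: acyclic_def)
  qed
  moreover have "range f \<subseteq> E\<^sup>* `` {f 0}"
  proof -
    have "(f 0, f j) \<in> E\<^sup>*" for j
      using path[of 0 j] by (cases "j = 0") (auto dest: trancl_into_rtrancl)
    then show ?thesis by auto
  qed
  moreover have "f 0 \<in> V" using step[of 0] moves_within by auto
  ultimately show False
    using finite_reachable finite_subset finite_imageD infinite_UNIV_nat by blast
qed

definition terminal :: "'a \<Rightarrow> bool" where
  "terminal x \<longleftrightarrow> E `` {x} = {}"

function grundy :: "'a \<Rightarrow> nat" where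
  "grundy x = mex (grundy ` (E `` {x}))"
  by auto
termination
  by (relation "E\<inverse>") (auto intro: wf_moves)

function misere_grundy :: "'a \<Rightarrow> nat" where
  "misere_grundy x = (if terminal x then 1 else mex (misere_grundy ` (E `` {x})))"
  by auto
termination
  by (relation "E\<inverse>") (auto intro: wf_moves)

declare grundy.simps [simp del] misere_grundy.simps [simp del]

definition positions :: "nat \<Rightarrow> nat \<Rightarrow> 'a set" where
  "positions i j = {x \<in> V. grundy x = i \<and> misere_grundy x = j}"

definition movable :: "'a \<Rightarrow> 'a set \<Rightarrow> bool" where
  "movable x W \<longleftrightarrow> (\<exists>y\<in>W. (x, y) \<in> E)"

definition domestic :: bool where
  "domestic \<longleftrightarrow> (\<forall>k\<ge>2. positions 0 k = {} \<and> positions k 0 = {})"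

definition weakly_miserable :: bool where
  "weakly_miserable \<longleftrightarrow> (\<forall>x\<in>V.
     x \<in> positions 0 1 \<union> positions 1 0 \<or>
     \<not> movable x (positions 0 1 \<union> positions 1 0) \<or>
     movable x (positions 0 1) \<and> movable x (positions 1 0) \<or>
     movable x (positions 0 1) \<and> movable x (positions 0 0) \<or>
     movable x (positions 1 0) \<and> movable x (positions 0 0))"

end

end

theory Submission
  imports Defs
begin

text \<open>In a domestic game, if \<open>x \<notin> V\<^sub>0\<^sub>1 \<union> V\<^sub>1\<^sub>0\<close> is movable to \<open>V\<^sub>0\<^sub>1\<close>,
  its misere value is at least \<open>2\<close>, so \<open>x\<close> also has a move to misere value \<open>0\<close>, that is, to
  \<open>V\<^sub>1\<^sub>0\<close> or \<open>V\<^sub>0\<^sub>0\<close>; dually for \<open>V\<^sub>1\<^sub>0\<close> and the normal value.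
  Conversely, argue by induction along the moves: a \<open>(0,k)\<close>-position with \<open>k \<ge> 2\<close> all of whose
  options respect domesticity is movable to \<open>V\<^sub>1\<^sub>0\<close> but to no position of normal value \<open>0\<close>, which
  excludes every clause of weak miserability; dually for \<open>(k,0)\<close>.\<close>

lemma mex_notin:
  assumes "finite S"
  shows "mex S \<notin> S"
proof -
  obtain n where "n \<notin> S"
    using ex_new_if_finite[OF infinite_UNIV_nat assms] by blast
  then show ?thesis
    unfolding mex_def by (rule LeastI)
qed

lemma less_mex_in: "n < mex S \<Longrightarrow> n \<in> S"
  unfolding mex_def using not_less_Least by blast

context impartial_game
begin

lemma finite_successors:
  assumes "x \<in> V"
  shows "finite (E `` {x})"
  by (rule finite_subset[OF _ finite_reachable[OF assms]]) auto

lemma grundy_move_neq: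
  assumes "(x, y) \<in> E"
  shows "grundy y \<noteq> grundy x"
proof -
  have "x \<in> V" using assms moves_within by blast
  then have "grundy x \<notin> grundy ` (E `` {x})"
    by (subst grundy.simps) (intro mex_notin finite_imageI finite_successors)
  then show ?thesis using assms by (metis Image_singleton_iff imageI)
qed

text \<open>A position with a move is not terminal, so its value is a genuine \<open>mex\<close>
  over a finite set.\<close>

lemma misere_grundy_move_neq:
  assumes "(x, y) \<in> E"
  shows "misere_grundy y \<noteq> misere_grundy x"
proof -
  have "x \<in> V" "\<not> terminal x"
    using assms moves_within by (auto simp: terminal_def)
  then have "misere_grundy x \<notin> misere_grundy ` (E `` {x})"
    by (subst misere_grundy.simps) (simp add: mex_notin finite_successors)
  then show ?thesis using assms by (metis Image_singleton_iff imageI)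
qed

lemma grundy_move_less:
  assumes "n < grundy x"
  obtains y where "(x, y) \<in> E" "grundy y = n"
  using less_mex_in[of n "grundy ` (E `` {x})"] assms
  by (auto simp: grundy.simps[of x])

text \<open>The hypothesis \<open>misere_grundy x \<noteq> 1\<close> excludes terminal positions.\<close>

lemma misere_grundy_move_less:
  assumes "n < misere_grundy x" "misere_grundy x \<noteq> 1"
  obtains y where "(x, y) \<in> E" "misere_grundy y = n"
  using less_mex_in[of n "misere_grundy ` (E `` {x})"] assms
  by (auto simp: misere_grundy.simps[of x] split: if_splits)

text \<open>This pointwise form can be proved by well-founded induction on the position.\<close>

lemma domestic_iff:
  "domestic \<longleftrightarrow> (\<forall>x\<in>V. (grundy x = 0 \<longrightarrow> misere_grundy x \<le> 1) \<and>
                     (misere_grundy x = 0 \<longrightarrow> grundy x \<le> 1))"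
proof -
  have "n \<le> 1 \<longleftrightarrow> (\<forall>k\<ge>2. n \<noteq> k)" for n :: nat
    by presburger
  then show ?thesis
    unfolding domestic_def positions_def by blast
qed

lemma weakly_miserable_imp_domestic:
  assumes wm: weakly_miserable
  shows domestic
proof -
  have "x \<in> V \<Longrightarrow> (grundy x = 0 \<longrightarrow> misere_grundy x \<le> 1) \<and>
                  (misere_grundy x = 0 \<longrightarrow> grundy x \<le> 1)" for x
  proof (induction x rule: wf_induct_rule[OF wf_moves])
    case (1 x)
    have IH: "y \<in> V" "grundy y = 0 \<Longrightarrow> misere_grundy y \<le> 1"
        "misere_grundy y = 0 \<Longrightarrow> grundy y \<le> 1" if "(x, y) \<in> E" for y
      using 1 that moves_within by auto
    note cases = wm[unfolded weakly_miserable_def, rule_format, OF \<open>x \<in> V\<close>,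
        unfolded movable_def positions_def]
    show ?case
    proof (intro conjI impI; rule ccontr)
      assume g: "grundy x = 0" and m: "\<not> misere_grundy x \<le> 1"
      obtain y where y: "(x, y) \<in> E" "misere_grundy y = 0"
        using misere_grundy_move_less[of 0 x] m by auto
      have "grundy y = 1"
        using IH(3)[OF y] grundy_move_neq[OF y(1)] g by simp
      \<comment> \<open>Since \<open>y\<close> is in \<open>positions 1 0\<close>, only the
        movability clauses remain. Each provides a move to \<open>positions 0 1\<close> or
        \<open>positions 0 0\<close>, hence to normal value 0.\<close>
      then show False
        using cases y IH(1)[OF y(1)] g m grundy_move_neq[of x] by fastforce
    next
      assume m: "misere_grundy x = 0" and g: "\<not> grundy x \<le> 1"
      obtain y where y: "(x, y) \<in> E" "grundy y = 0"
        using grundy_move_less[of 0 x] g by auto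
      have "misere_grundy y = 1"
        using IH(2)[OF y] misere_grundy_move_neq[OF y(1)] m by simp
      \<comment> \<open>Dually, each remaining clause provides a move to misere value 0.\<close>
      then show False
        using cases y IH(1)[OF y(1)] g m misere_grundy_move_neq[of x] by fastforce
    qed
  qed
  then show ?thesis by (simp add: domestic_iff)
qed

lemma domestic_imp_weakly_miserable:
  assumes domestic
  shows weakly_miserable
proof -
  have dom: "grundy x = 0 \<Longrightarrow> misere_grundy x = 0 \<or> misere_grundy x = 1"
      "misere_grundy x = 0 \<Longrightarrow> grundy x = 0 \<or> grundy x = 1" if "x \<in> V" for x
    using assms that unfolding domestic_iff by (auto simp: le_Suc_eq)
  have c01: "movable x (positions 1 0) \<or> movable x (positions 0 0)"
    if x: "x \<in> V" "x \<notin> positions 0 1 \<union> positions 1 0" and mv: "movable x (positions 0 1)" for x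
  proof -
    obtain y where y: "(x, y) \<in> E" "grundy y = 0" "misere_grundy y = 1"
      using mv by (auto simp: movable_def positions_def)
    have "grundy x \<noteq> 0" "misere_grundy x \<noteq> 1"
      using grundy_move_neq[OF y(1)] misere_grundy_move_neq[OF y(1)] y by auto
    \<comment> \<open>Otherwise domesticity and \<open>grundy x \<noteq> 0\<close> would put
      \<open>x\<close> in \<open>positions 1 0\<close>.\<close>
    moreover from this have "misere_grundy x \<noteq> 0"
      using dom(2)[OF x(1)] x by (auto simp: positions_def)
    ultimately obtain z where z: "(x, z) \<in> E" "misere_grundy z = 0"
      using misere_grundy_move_less[of 0 x] by auto
    moreover have "z \<in> V" using z moves_within by auto
    ultimately show ?thesis
      using dom(2)[of z] by (auto simp: movable_def positions_def)
  qed
  have c10: "movable x (positions 0 1) \<or> movable x (positions 0 0)"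
    if x: "x \<in> V" "x \<notin> positions 0 1 \<union> positions 1 0" and mv: "movable x (positions 1 0)" for x
  proof -
    obtain y where y: "(x, y) \<in> E" "misere_grundy y = 0"
      using mv by (auto simp: movable_def positions_def)
    have "misere_grundy x \<noteq> 0"
      using misere_grundy_move_neq[OF y(1)] y by auto
    \<comment> \<open>Otherwise domesticity would put \<open>x\<close> in
      \<open>positions 0 1\<close>.\<close>
    then have "grundy x \<noteq> 0"
      using dom(1)[OF x(1)] x by (auto simp: positions_def)
    then obtain z where z: "(x, z) \<in> E" "grundy z = 0"
      using grundy_move_less[of 0 x] by auto
    moreover have "z \<in> V" using z moves_within by auto
    ultimately show ?thesis
      using dom(1)[of z] by (auto simp: movable_def positions_def)
  qed
  \<comment> \<open>Splits the failure of the second clause into the cases handled by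
    \<open>c01\<close> and \<open>c10\<close>.\<close>
  have "movable x (A \<union> B) \<longleftrightarrow> movable x A \<or> movable x B" for x A B
    by (auto simp: movable_def)
  then show ?thesis
    unfolding weakly_miserable_def using c01 c10 by blast
qed

end

theorem theorem3p2:
  fixes V :: "'a set" and E :: "'a rel"
  assumes "impartial_game V E"
  shows "impartial_game.weakly_miserable V E \<longleftrightarrow> impartial_game.domestic V E"
  using impartial_game.weakly_miserable_imp_domestic[OF assms]
    impartial_game.domestic_imp_weakly_miserable[OF assms] by blast

end
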